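(* Let $N\ge 1$ be an integer and let $R$ be a bijection on $[N]^2=[N]\times[N]$. For $k\ge 2$ let $\mathbb{F}_{R,k}^+$ be the unital semigroup $$\mathbb{F}_{R,k}^+=\Big\langle e^i_{\mathfrak t},\ \mathfrak t\in[N],\ 1\le i\le k\ ;\ e^i_{\mathfrak s}e^j_{\mathfrak t}=e^j_{\mathfrak t'}e^i_{\mathfrak s'}\ \text{ for } 1\le i<j\le k \text{ whenever } R(\mathfrak s,\mathfrak t)=(\mathfrak t',\mathfrak s')\Big\rangle .$$ Then the following statements are equivalent: (i) $R$ is a solution of the Yang–Baxter equation on $[N]$; (ii) $R$ determines a single-vertex $3$-graph $\mathbb{F}_{R,3}^+$; (iii) for every integer $k\ge 3$, $R$ determines a single-vertex $k$-graph $\mathbb{F}_{R,k}^+$.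
   Context: $[N]=\{1,\dots,N\}$, and $\mathbb{N}$ denotes the non-negative integers. A bijection $R:X^2\to X^2$ is a (set-theoretic) solution of the Yang–Baxter equation on $X$ if $R_{12}R_{23}R_{12}=R_{23}R_{12}R_{23}$ on $X^3$, where $R_{12}=R\times \mathrm{id}_X$ and $R_{23}=\mathrm{id}_X\times R$. A $k$-graph is a countable small category $\Lambda$ with a degree functor $d:\Lambda\to\mathbb{N}^k$ (with $\mathbb{N}^k$ regarded as a one-object category) having the factorization property: whenever $d(\lambda)=\mathbf m+\mathbf n$ there are unique $\mu,\nu\in\Lambda$ with $d(\mu)=\mathbf m$, $d(\nu)=\mathbf n$ and $\lambda=\mu\nu$. It is single-vertex if it has exactly one object, in which case it is a unital semigroup. Let $\epsilon_1,\dots,\epsilon_k$ be the standard basis of $\mathbb{N}^k$. The semigroup $\mathbb{F}_{R,k}^+$ carries the degree homomorphism $d$ determined by $d(e^i_{\mathfrak t})=\epsilon_i$. "$R$ determines a single-vertex $k$-graph $\mathbb{F}_{R,k}^+$" means that $(\mathbb{F}_{R,k}^+,d)$ is a $k$-graph, i.e. has the factorization property. *)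

theory Defs
  imports "HOL-Algebra.Group" "HOL-Library.Countable_Set"
begin

section \<open>Set-theoretic solutions of the Yang--Baxter equation\<close>

text \<open>\<open>X\<^sup>3\<close> is rendered as \<open>X \<times> X \<times> X\<close>, i.e. with triples nested to the right.\<close>

definition R12 :: "('a \<times> 'a \<Rightarrow> 'a \<times> 'a) \<Rightarrow> 'a \<times> 'a \<times> 'a \<Rightarrow> 'a \<times> 'a \<times> 'a" where
  "R12 R = (\<lambda>(x, y, z). (fst (R (x, y)), snd (R (x, y)), z))"

definition R23 :: "('a \<times> 'a \<Rightarrow> 'a \<times> 'a) \<Rightarrow> 'a \<times> 'a \<times> 'a \<Rightarrow> 'a \<times> 'a \<times> 'a" where
  "R23 R = map_prod id R"

definition YBE_solution :: "'a set \<Rightarrow> ('a \<times> 'a \<Rightarrow> 'a \<times> 'a) \<Rightarrow> bool" where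
  "YBE_solution X R \<longleftrightarrow>
     bij_betw R (X \<times> X) (X \<times> X) \<and>
     (\<forall>v \<in> X \<times> X \<times> X. (R12 R \<circ> R23 R \<circ> R12 R) v = (R23 R \<circ> R12 R \<circ> R23 R) v)"


section \<open>Small categories and \<open>k\<close>-graphs\<close>

record ('o, 'm) small_cat =
  Obj :: "'o set"
  Mor :: "'m set"
  src :: "'m \<Rightarrow> 'o"
  rng :: "'m \<Rightarrow> 'o"
  ident :: "'o \<Rightarrow> 'm"
  cmp :: "'m \<Rightarrow> 'm \<Rightarrow> 'm"

text \<open>The composite \<open>\<mu>\<nu>\<close>, written \<open>cmp C \<mu> \<nu>\<close>, is meaningful when \<open>src C \<mu> = rng C \<nu>\<close>.\<close>

locale small_category =
  fixes C :: "('o, 'm) small_cat"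
  assumes src_closed: "\<mu> \<in> Mor C \<Longrightarrow> src C \<mu> \<in> Obj C"
    and rng_closed: "\<mu> \<in> Mor C \<Longrightarrow> rng C \<mu> \<in> Obj C"
    and ident_closed: "v \<in> Obj C \<Longrightarrow> ident C v \<in> Mor C"
    and src_ident: "v \<in> Obj C \<Longrightarrow> src C (ident C v) = v"
    and rng_ident: "v \<in> Obj C \<Longrightarrow> rng C (ident C v) = v"
    and cmp_closed: "\<lbrakk>\<mu> \<in> Mor C; \<nu> \<in> Mor C; src C \<mu> = rng C \<nu>\<rbrakk> \<Longrightarrow> cmp C \<mu> \<nu> \<in> Mor C"
    and src_cmp: "\<lbrakk>\<mu> \<in> Mor C; \<nu> \<in> Mor C; src C \<mu> = rng C \<nu>\<rbrakk> \<Longrightarrow> src C (cmp C \<mu> \<nu>) = src C \<nu>"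
    and rng_cmp: "\<lbrakk>\<mu> \<in> Mor C; \<nu> \<in> Mor C; src C \<mu> = rng C \<nu>\<rbrakk> \<Longrightarrow> rng C (cmp C \<mu> \<nu>) = rng C \<mu>"
    and cmp_assoc: "\<lbrakk>\<mu> \<in> Mor C; \<nu> \<in> Mor C; \<xi> \<in> Mor C; src C \<mu> = rng C \<nu>; src C \<nu> = rng C \<xi>\<rbrakk>
      \<Longrightarrow> cmp C (cmp C \<mu> \<nu>) \<xi> = cmp C \<mu> (cmp C \<nu> \<xi>)"
    and ident_left: "\<mu> \<in> Mor C \<Longrightarrow> cmp C (ident C (rng C \<mu>)) \<mu> = \<mu>"
    and ident_right: "\<mu> \<in> Mor C \<Longrightarrow> cmp C \<mu> (ident C (src C \<mu>)) = \<mu>"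

text \<open>\<open>\<nat>\<^sup>k\<close> as the functions on \<open>nat\<close> that vanish off the index set \<open>{1..k}\<close>.\<close>

definition Nk :: "nat \<Rightarrow> (nat \<Rightarrow> nat) set" where
  "Nk k = {n. \<forall>i. i \<notin> {1..k} \<longrightarrow> n i = 0}"

definition Nk_add :: "(nat \<Rightarrow> nat) \<Rightarrow> (nat \<Rightarrow> nat) \<Rightarrow> nat \<Rightarrow> nat" where
  "Nk_add m n = (\<lambda>i. m i + n i)"

definition Nk_unit :: "nat \<Rightarrow> nat \<Rightarrow> nat" where
  "Nk_unit i = (\<lambda>j. if j = i then 1 else 0)"

text \<open>Countability of \<open>Mor C\<close> entails that of \<open>Obj C\<close>, since \<open>ident C\<close> is injective on objects.\<close>

locale k_graph = small_category C for C :: "('o, 'm) small_cat" +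
  fixes k :: nat and d :: "'m \<Rightarrow> nat \<Rightarrow> nat"
  assumes countable_Mor: "countable (Mor C)"
    and degree_closed: "\<mu> \<in> Mor C \<Longrightarrow> d \<mu> \<in> Nk k"
    and degree_ident: "v \<in> Obj C \<Longrightarrow> d (ident C v) = (\<lambda>_. 0)"
    and degree_cmp: "\<lbrakk>\<mu> \<in> Mor C; \<nu> \<in> Mor C; src C \<mu> = rng C \<nu>\<rbrakk>
      \<Longrightarrow> d (cmp C \<mu> \<nu>) = Nk_add (d \<mu>) (d \<nu>)"
    and factorization: "\<lbrakk>\<xi> \<in> Mor C; m \<in> Nk k; n \<in> Nk k; d \<xi> = Nk_add m n\<rbrakk>
      \<Longrightarrow> \<exists>!(\<mu>, \<nu>). \<mu> \<in> Mor C \<and> \<nu> \<in> Mor C \<and> src C \<mu> = rng C \<nu> \<and>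
             d \<mu> = m \<and> d \<nu> = n \<and> \<xi> = cmp C \<mu> \<nu>"

locale single_vertex_k_graph = k_graph +
  assumes single_vertex: "\<exists>!v. v \<in> Obj C"

definition monoid_cat :: "('m, 'b) monoid_scheme \<Rightarrow> (unit, 'm) small_cat" where
  "monoid_cat M =
     \<lparr>Obj = {()}, Mor = carrier M, src = (\<lambda>_. ()), rng = (\<lambda>_. ()),
      ident = (\<lambda>_. \<one>\<^bsub>M\<^esub>), cmp = (\<lambda>x y. x \<otimes>\<^bsub>M\<^esub> y)\<rparr>"


section \<open>Monoids given by generators and relations\<close>

inductive_set pres_cong :: "'a set \<Rightarrow> ('a list \<times> 'a list) set \<Rightarrow> ('a list \<times> 'a list) set"
  for A :: "'a set" and E :: "('a list \<times> 'a list) set" where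
  rel: "\<lbrakk>(u, v) \<in> E; u \<in> lists A; v \<in> lists A\<rbrakk> \<Longrightarrow> (u, v) \<in> pres_cong A E"
| refl: "u \<in> lists A \<Longrightarrow> (u, u) \<in> pres_cong A E"
| sym: "(u, v) \<in> pres_cong A E \<Longrightarrow> (v, u) \<in> pres_cong A E"
| trans: "\<lbrakk>(u, v) \<in> pres_cong A E; (v, w) \<in> pres_cong A E\<rbrakk> \<Longrightarrow> (u, w) \<in> pres_cong A E"
| app: "\<lbrakk>(u, v) \<in> pres_cong A E; (u', v') \<in> pres_cong A E\<rbrakk> \<Longrightarrow> (u @ u', v @ v') \<in> pres_cong A E"

text \<open>The product of two classes is the class of \<open>u @ v\<close> for any choice of representatives.\<close>

definition pres_monoid :: "'a set \<Rightarrow> ('a list \<times> 'a list) set \<Rightarrow> 'a list set monoid" where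
  "pres_monoid A E =
     \<lparr>carrier = lists A // pres_cong A E,
      mult = (\<lambda>c c'. \<Union>u\<in>c. \<Union>v\<in>c'. pres_cong A E `` {u @ v}),
      one = pres_cong A E `` {[]}\<rparr>"

lemma pres_cong_lists: "(u, v) \<in> pres_cong A E \<Longrightarrow> u \<in> lists A \<and> v \<in> lists A"
  by (induction rule: pres_cong.induct) auto

lemma equiv_pres_cong: "equiv (lists A) (pres_cong A E)"
proof (rule equivI)
  show "refl_on (lists A) (pres_cong A E)"
    by (rule refl_onI) (rule pres_cong.refl)
  show "pres_cong A E \<subseteq> lists A \<times> lists A"
    using pres_cong_lists by fast
  show "sym (pres_cong A E)"
    by (rule symI) (rule pres_cong.sym)
  show "trans (pres_cong A E)"
    by (rule transI) (rule pres_cong.trans)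
qed

lemma pres_mult_class:
  assumes "u \<in> lists A" "v \<in> lists A"
  shows "(pres_cong A E `` {u}) \<otimes>\<^bsub>pres_monoid A E\<^esub> (pres_cong A E `` {v}) = pres_cong A E `` {u @ v}"
proof -
  let ?c = "\<lambda>w. pres_cong A E `` {w}"
  have eq: "?c (x @ y) = ?c (u @ v)" if "x \<in> ?c u" "y \<in> ?c v" for x y
  proof -
    have "(u @ v, x @ y) \<in> pres_cong A E"
      using that by (simp add: pres_cong.app)
    then show ?thesis
      using equiv_class_eq[OF equiv_pres_cong] by fast
  qed
  have "u \<in> ?c u" "v \<in> ?c v"
    using assms by (simp_all add: pres_cong.refl)
  with eq have "(\<Union>x\<in>?c u. \<Union>y\<in>?c v. ?c (x @ y)) = ?c (u @ v)"
    by blast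
  then show ?thesis
    by (simp add: pres_monoid_def)
qed

lemma monoid_pres_monoid: "monoid (pres_monoid A E)"
proof -
  let ?M = "pres_monoid A E" and ?c = "\<lambda>u. pres_cong A E `` {u}"
  have car: "x \<in> carrier ?M \<longleftrightarrow> (\<exists>u \<in> lists A. x = ?c u)" for x
    by (auto simp: pres_monoid_def quotient_def)
  have one: "\<one>\<^bsub>?M\<^esub> = ?c []" by (simp add: pres_monoid_def)
  have app: "u @ v \<in> lists A" if "u \<in> lists A" "v \<in> lists A" for u v using that by simp
  show ?thesis
  proof (rule monoidI)
    show "x \<otimes>\<^bsub>?M\<^esub> y \<in> carrier ?M" if "x \<in> carrier ?M" "y \<in> carrier ?M" for x y
      using that unfolding car by (metis app pres_mult_class)
    show "\<one>\<^bsub>?M\<^esub> \<in> carrier ?M" unfolding car one by blast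
    show "(x \<otimes>\<^bsub>?M\<^esub> y) \<otimes>\<^bsub>?M\<^esub> z = x \<otimes>\<^bsub>?M\<^esub> (y \<otimes>\<^bsub>?M\<^esub> z)"
      if "x \<in> carrier ?M" "y \<in> carrier ?M" "z \<in> carrier ?M" for x y z
    proof -
      from that obtain u v w where "u \<in> lists A" "v \<in> lists A" "w \<in> lists A"
        and "x = ?c u" "y = ?c v" "z = ?c w" unfolding car by blast
      then show ?thesis by (simp add: pres_mult_class app del: append_in_lists_conv)
    qed
    show "\<one>\<^bsub>?M\<^esub> \<otimes>\<^bsub>?M\<^esub> x = x" if "x \<in> carrier ?M" for x
      using that unfolding car one by (metis append_Nil lists.Nil pres_mult_class)
    show "x \<otimes>\<^bsub>?M\<^esub> \<one>\<^bsub>?M\<^esub> = x" if "x \<in> carrier ?M" for x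
      using that unfolding car one by (metis append_Nil2 lists.Nil pres_mult_class)
  qed
qed


section \<open>The unital semigroup of \<open>R\<close> and its degree homomorphism\<close>

text \<open>The generator with colour \<open>i\<close> and index \<open>t\<close> is encoded as the letter \<open>(i, t)\<close>.\<close>

definition FR_gens :: "nat \<Rightarrow> nat \<Rightarrow> (nat \<times> nat) set" where
  "FR_gens N k = {1..k} \<times> {1..N}"

definition FR_rels ::
    "nat \<Rightarrow> (nat \<times> nat \<Rightarrow> nat \<times> nat) \<Rightarrow> nat \<Rightarrow> ((nat \<times> nat) list \<times> (nat \<times> nat) list) set" where
  "FR_rels N R k =
     {([(i, s), (j, t)], [(j, t'), (i, s')]) | i j s t s' t'.
        1 \<le> i \<and> i < j \<and> j \<le> k \<and> s \<in> {1..N} \<and> t \<in> {1..N} \<and> R (s, t) = (t', s')}"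

definition FR :: "nat \<Rightarrow> (nat \<times> nat \<Rightarrow> nat \<times> nat) \<Rightarrow> nat \<Rightarrow> (nat \<times> nat) list set monoid" where
  "FR N R k = pres_monoid (FR_gens N k) (FR_rels N R k)"

definition FR_gen :: "nat \<Rightarrow> (nat \<times> nat \<Rightarrow> nat \<times> nat) \<Rightarrow> nat \<Rightarrow> nat \<Rightarrow> nat \<Rightarrow> (nat \<times> nat) list set" where
  "FR_gen N R k i t = pres_cong (FR_gens N k) (FR_rels N R k) `` {[(i, t)]}"

definition word_degree :: "(nat \<times> nat) list \<Rightarrow> nat \<Rightarrow> nat" where
  "word_degree w = foldr (\<lambda>(i, t). Nk_add (Nk_unit i)) w (\<lambda>_. 0)"

text \<open>
  All words in a class have the same degree (\<open>word_degree_cong\<close> below), so the image is a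
  singleton; \<open>FR_degree_gen\<close>, \<open>FR_degree_one\<close> and \<open>FR_degree_mult\<close> say that this is the
  homomorphism determined by its values on the generators.
\<close>

definition FR_degree :: "(nat \<times> nat) list set \<Rightarrow> nat \<Rightarrow> nat" where
  "FR_degree c = the_elem (word_degree ` c)"

lemma word_degree_append: "word_degree (u @ v) = Nk_add (word_degree u) (word_degree v)"
  by (induction u) (auto simp: word_degree_def Nk_add_def fun_eq_iff)

lemma word_degree_cong:
  "(u, v) \<in> pres_cong (FR_gens N k) (FR_rels N R k) \<Longrightarrow> word_degree u = word_degree v"
proof (induction rule: pres_cong.induct)
  case (rel u v)
  then show ?case
    by (auto simp: FR_rels_def word_degree_def Nk_add_def fun_eq_iff)
qed (auto simp: word_degree_append)

lemma FR_degree_class: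
  assumes "w \<in> lists (FR_gens N k)"
  shows "FR_degree (pres_cong (FR_gens N k) (FR_rels N R k) `` {w}) = word_degree w"
proof -
  have "word_degree ` (pres_cong (FR_gens N k) (FR_rels N R k) `` {w}) = {word_degree w}"
    using word_degree_cong pres_cong.refl[OF assms] by fastforce
  then show ?thesis by (simp add: FR_degree_def)
qed

lemma FR_degree_gen:
  assumes "i \<in> {1..k}" "t \<in> {1..N}"
  shows "FR_degree (FR_gen N R k i t) = Nk_unit i"
proof -
  have "[(i, t)] \<in> lists (FR_gens N k)" using assms by (simp add: FR_gens_def)
  then show ?thesis
    unfolding FR_gen_def by (subst FR_degree_class) (auto simp: word_degree_def Nk_add_def)
qed

lemma FR_degree_one: "FR_degree \<one>\<^bsub>FR N R k\<^esub> = (\<lambda>_. 0)"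
  using FR_degree_class[of "[]" N k R] by (simp add: FR_def pres_monoid_def word_degree_def)

lemma FR_degree_mult:
  assumes "x \<in> carrier (FR N R k)" "y \<in> carrier (FR N R k)"
  shows "FR_degree (x \<otimes>\<^bsub>FR N R k\<^esub> y) = Nk_add (FR_degree x) (FR_degree y)"
proof -
  from assms obtain u v where "u \<in> lists (FR_gens N k)" "v \<in> lists (FR_gens N k)"
    and "x = pres_cong (FR_gens N k) (FR_rels N R k) `` {u}"
    and "y = pres_cong (FR_gens N k) (FR_rels N R k) `` {v}"
    by (auto simp: FR_def pres_monoid_def quotient_def)
  then show ?thesis
    by (simp add: FR_def pres_mult_class FR_degree_class word_degree_append)
qed

definition determines_single_vertex_k_graph :: "nat \<Rightarrow> (nat \<times> nat \<Rightarrow> nat \<times> nat) \<Rightarrow> nat \<Rightarrow> bool" where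
  "determines_single_vertex_k_graph N R k \<longleftrightarrow>
     single_vertex_k_graph (monoid_cat (FR N R k)) k FR_degree"

end

theory Submission imports Defs begin

text \<open>
  Read a defining relation as a move: two adjacent letters of distinct colours exchange their
  colours, and their indices are transformed by \<open>R\<close> when the colours were in ascending order and by
  \<open>R\<inverse>\<close> otherwise. A \<open>k\<close>-graph structure means that every word can be rewritten so that its colours
  come in any prescribed order, and that the word and this order determine the indices of the result.

  If this uniqueness holds, reverse the colours of \<open>e\<^sup>1\<^sub>a e\<^sup>2\<^sub>b e\<^sup>3\<^sub>c\<close>. There are two ways of doing so by
  adjacent exchanges. They compute \<open>R\<^sub>1\<^sub>2R\<^sub>2\<^sub>3R\<^sub>1\<^sub>2\<close> and \<open>R\<^sub>2\<^sub>3R\<^sub>1\<^sub>2R\<^sub>2\<^sub>3\<close> on \<open>(a, b, c)\<close>, so the two maps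
  agree (\<open>YBE_if_k_graph\<close>).

  Conversely, rewriting to some order is always possible because \<open>R\<close> is a bijection
  (\<open>factorization_exists\<close>); the point is uniqueness. Every letter \<open>x\<close> acts on words by insertion: it
  moves to the right past all initial letters of smaller colour. The Yang--Baxter equation
  makes these operators satisfy the defining relations (\<open>insert_letter_commute\<close>), so the monoid
  acts on words, and letting a word act on the empty word gives a normal form that depends only on
  its class. Insertion of a letter of known colour can be undone (\<open>insert_letter_inject\<close>). Hence
  \<open>x v \<sim> x' v'\<close> with \<open>x\<close> and \<open>x'\<close> of the same colour forces \<open>x = x'\<close> and \<open>v \<sim> v'\<close>, and unique
  factorization follows one letter at a time (\<open>factorization_unique\<close>).
\<close>

section \<open>Factorization in terms of words\<close>

abbreviation words :: "nat \<Rightarrow> nat \<Rightarrow> (nat \<times> nat) list set" where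
  "words N k \<equiv> lists (FR_gens N k)"

abbreviation word_cong :: "nat \<Rightarrow> (nat \<times> nat \<Rightarrow> nat \<times> nat) \<Rightarrow> nat \<Rightarrow> ((nat \<times> nat) list \<times> (nat \<times> nat) list) set" where
  "word_cong N R k \<equiv> pres_cong (FR_gens N k) (FR_rels N R k)"

lemma word_degree_Nil: "word_degree [] = (\<lambda>_. 0)"
  by (simp add: word_degree_def)

lemma word_degree_Cons: "word_degree ((i, t) # w) = Nk_add (Nk_unit i) (word_degree w)"
  by (simp add: word_degree_def)

lemma word_degree_Nk: "w \<in> words N k \<Longrightarrow> word_degree w \<in> Nk k"
  by (induction w)
    (auto simp: word_degree_Nil word_degree_Cons Nk_def Nk_add_def Nk_unit_def FR_gens_def)

lemma word_degree_eq_zero: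
  assumes "word_degree w = (\<lambda>_. 0)"
  shows "w = []"
proof (cases w)
  case (Cons x w')
  then have "word_degree w (fst x) \<noteq> 0"
    by (cases x) (simp add: word_degree_Cons Nk_add_def Nk_unit_def)
  then show ?thesis using assms by simp
qed

lemma word_degree_eq_unit:
  assumes "word_degree w = Nk_unit i"
  obtains t where "w = [(i, t)]"
proof (cases w)
  case Nil
  then show ?thesis
    using assms by (auto simp: word_degree_Nil Nk_unit_def fun_eq_iff split: if_splits)
next
  case (Cons x w')
  obtain j t where x: "x = (j, t)" by (metis surj_pair)
  have eq: "Nk_unit j l + word_degree w' l = Nk_unit i l" for l
    using assms by (simp add: Cons x word_degree_Cons Nk_add_def fun_eq_iff)
  from eq[of j] have "i = j"
    by (auto simp: Nk_unit_def split: if_splits)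
  moreover from this have "word_degree w' = (\<lambda>_. 0)"
    using eq by (auto simp: fun_eq_iff)
  ultimately show ?thesis
    using that Cons x word_degree_eq_zero by blast
qed

text \<open>
  Everything in the definition of a single-vertex \<open>k\<close>-graph other than factorization holds for any
  presented monoid of this shape. For factorization, choosing representatives turns a statement about
  classes into one about words.
\<close>

lemma determines_single_vertex_k_graph_iff:
  "determines_single_vertex_k_graph N R k \<longleftrightarrow>
     (\<forall>w \<in> words N k. \<forall>m \<in> Nk k. \<forall>n \<in> Nk k. word_degree w = Nk_add m n \<longrightarrow>
        (\<exists>u v. u \<in> words N k \<and> v \<in> words N k \<and> word_degree u = m \<and> word_degree v = n \<and>
           (w, u @ v) \<in> word_cong N R k)) \<and>
     (\<forall>u v u' v'. (u @ v, u' @ v') \<in> word_cong N R k \<and>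
        word_degree u = word_degree u' \<and> word_degree v = word_degree v' \<longrightarrow>
        (u, u') \<in> word_cong N R k \<and> (v, v') \<in> word_cong N R k)"
  (is "_ \<longleftrightarrow> ?E \<and> ?U")
proof -
  let ?M = "FR N R k" and ?c = "\<lambda>w. word_cong N R k `` {w}"
  have car: "x \<in> carrier ?M \<longleftrightarrow> (\<exists>u \<in> words N k. x = ?c u)" for x
    by (auto simp: FR_def pres_monoid_def quotient_def)
  have mult: "?c u \<otimes>\<^bsub>?M\<^esub> ?c v = ?c (u @ v)" if "u \<in> words N k" "v \<in> words N k" for u v
    using that by (simp add: FR_def pres_mult_class)
  have deg: "FR_degree (?c u) = word_degree u" if "u \<in> words N k" for u
    using that by (rule FR_degree_class)
  have eq: "?c u = ?c v \<longleftrightarrow> (u, v) \<in> word_cong N R k" if "u \<in> words N k" "v \<in> words N k" for u v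
    using that by (simp add: eq_equiv_class_iff[OF equiv_pres_cong])
  interpret monoid ?M
    unfolding FR_def by (rule monoid_pres_monoid)
  show ?thesis
  proof
    assume "determines_single_vertex_k_graph N R k"
    then interpret single_vertex_k_graph "monoid_cat ?M" k FR_degree
      by (simp add: determines_single_vertex_k_graph_def)
    have fac: "\<exists>!(x, y). x \<in> carrier ?M \<and> y \<in> carrier ?M \<and> FR_degree x = m \<and> FR_degree y = n \<and>
        z = x \<otimes>\<^bsub>?M\<^esub> y"
      if "z \<in> carrier ?M" "m \<in> Nk k" "n \<in> Nk k" "FR_degree z = Nk_add m n" for z m n
      using factorization[of z m n] that by (simp add: monoid_cat_def)
    have ?E
    proof (intro ballI impI)
      fix w m n
      assume w: "w \<in> words N k" and m: "m \<in> Nk k" "n \<in> Nk k" and d: "word_degree w = Nk_add m n"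
      have "?c w \<in> carrier ?M" using w car by blast
      from fac[OF this m] d deg[OF w] obtain x y where "x \<in> carrier ?M" "y \<in> carrier ?M"
        and xy: "FR_degree x = m" "FR_degree y = n" "?c w = x \<otimes>\<^bsub>?M\<^esub> y"
        by auto
      then obtain u v where uv: "u \<in> words N k" "v \<in> words N k" "x = ?c u" "y = ?c v"
        unfolding car by blast
      then have "?c w = ?c (u @ v)" using xy mult by simp
      then have "(w, u @ v) \<in> word_cong N R k"
        using uv w eq[of w "u @ v"] by simp
      then show "\<exists>u v. u \<in> words N k \<and> v \<in> words N k \<and> word_degree u = m \<and> word_degree v = n \<and>
           (w, u @ v) \<in> word_cong N R k"
        using uv xy deg by auto
    qed
    moreover have ?U
    proof (intro allI impI, elim conjE)
      fix u v u' v'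
      assume c: "(u @ v, u' @ v') \<in> word_cong N R k"
        and d: "word_degree u = word_degree u'" "word_degree v = word_degree v'"
      have l: "u \<in> words N k" "v \<in> words N k" "u' \<in> words N k" "v' \<in> words N k"
        using pres_cong_lists[OF c] by auto
      have "?c (u @ v) \<in> carrier ?M" using l car by force
      moreover have "FR_degree (?c (u @ v)) = Nk_add (word_degree u) (word_degree v)"
        using deg[of "u @ v"] l by (simp add: word_degree_append)
      ultimately have ex1: "\<exists>!(x, y). x \<in> carrier ?M \<and> y \<in> carrier ?M \<and> FR_degree x = word_degree u \<and>
          FR_degree y = word_degree v \<and> ?c (u @ v) = x \<otimes>\<^bsub>?M\<^esub> y"
        by (rule fac[OF _ word_degree_Nk[OF l(1)] word_degree_Nk[OF l(2)]])
      let ?P = "\<lambda>(x, y). x \<in> carrier ?M \<and> y \<in> carrier ?M \<and> FR_degree x = word_degree u \<and>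
          FR_degree y = word_degree v \<and> ?c (u @ v) = x \<otimes>\<^bsub>?M\<^esub> y"
      have cc: "?c x \<in> carrier ?M" if "x \<in> words N k" for x
        using that car by blast
      have "?c (u @ v) = ?c (u' @ v')"
        using c l eq[of "u @ v" "u' @ v'"] by simp
      then have P': "?P (?c u', ?c v')"
        using cc l deg mult d by simp
      have P: "?P (?c u, ?c v)"
        using cc l deg mult by simp
      have "(?c u, ?c v) = (?c u', ?c v')"
        by (rule HOL.trans[OF HOL.sym[OF the1_equality[OF ex1 P]] the1_equality[OF ex1 P']])
      then show "(u, u') \<in> word_cong N R k \<and> (v, v') \<in> word_cong N R k"
        using l eq by simp
    qed
    ultimately show "?E \<and> ?U" by blast
  next
    assume EU: "?E \<and> ?U"
    have "single_vertex_k_graph (monoid_cat ?M) k FR_degree"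
    proof (unfold_locales; (simp add: monoid_cat_def m_assoc FR_degree_one FR_degree_mult; fail)?)
      have "countable (words N k)"
        by (simp add: FR_gens_def)
      then have "countable (carrier ?M)"
        unfolding FR_def pres_monoid_def quotient_def by simp
      then show "countable (Mor (monoid_cat ?M))"
        by (simp add: monoid_cat_def)
    next
      fix x assume "x \<in> Mor (monoid_cat ?M)"
      then obtain u where "u \<in> words N k" "x = ?c u"
        using car by (auto simp: monoid_cat_def)
      then show "FR_degree x \<in> Nk k"
        using deg word_degree_Nk by simp
    next
      fix z m n
      assume "z \<in> Mor (monoid_cat ?M)" and mn: "m \<in> Nk k" "n \<in> Nk k" and d: "FR_degree z = Nk_add m n"
      then obtain w where w: "w \<in> words N k" "z = ?c w"
        using car by (auto simp: monoid_cat_def)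
      then obtain u v where uv: "u \<in> words N k" "v \<in> words N k" "word_degree u = m"
        "word_degree v = n" "(w, u @ v) \<in> word_cong N R k"
        using EU mn d deg by metis
      have z: "z = ?c (u @ v)"
        using uv w eq[of w "u @ v"] by simp
      have unique: "(x, y) = (?c u, ?c v)"
        if xy: "x \<in> carrier ?M" "y \<in> carrier ?M" "FR_degree x = m" "FR_degree y = n" "z = x \<otimes>\<^bsub>?M\<^esub> y" for x y
      proof -
        obtain u' v' where u'v': "u' \<in> words N k" "v' \<in> words N k" "x = ?c u'" "y = ?c v'"
          using xy(1,2) unfolding car by blast
        then have "?c (u @ v) = ?c (u' @ v')"
          using mult[of u' v'] xy(5) z by metis
        then have "(u @ v, u' @ v') \<in> word_cong N R k"
          using uv u'v' eq[of "u @ v" "u' @ v'"] by simp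
        moreover have "word_degree u = word_degree u'" "word_degree v = word_degree v'"
          using u'v' xy uv deg by auto
        ultimately have "(u, u') \<in> word_cong N R k \<and> (v, v') \<in> word_cong N R k"
          using EU by blast
        then show ?thesis using u'v' uv eq[of u u'] eq[of v v'] by simp
      qed
      let ?P = "\<lambda>(x, y). x \<in> carrier ?M \<and> y \<in> carrier ?M \<and> FR_degree x = m \<and>
          FR_degree y = n \<and> z = x \<otimes>\<^bsub>?M\<^esub> y"
      have "?c u \<in> carrier ?M" "?c v \<in> carrier ?M"
        using uv(1,2) unfolding car by blast+
      then have "?P (?c u, ?c v)"
        using deg[OF uv(1)] deg[OF uv(2)] mult[OF uv(1,2)] uv(3,4) z by simp
      moreover have "p = (?c u, ?c v)" if "?P p" for p
        using that unique[of "fst p" "snd p"] by (simp add: case_prod_beta)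
      ultimately have "\<exists>!p. ?P p"
        by (rule ex1I)
      then show "\<exists>!(x, y). x \<in> Mor (monoid_cat ?M) \<and> y \<in> Mor (monoid_cat ?M) \<and>
          src (monoid_cat ?M) x = rng (monoid_cat ?M) y \<and> FR_degree x = m \<and> FR_degree y = n \<and>
          z = cmp (monoid_cat ?M) x y"
        by (simp add: monoid_cat_def)
    next
      show "\<exists>!v. v \<in> Obj (monoid_cat ?M)"
        by (simp add: monoid_cat_def Ex1_def)
    qed
    then show "determines_single_vertex_k_graph N R k"
      by (simp add: determines_single_vertex_k_graph_def)
  qed
qed

section \<open>From unique factorization to the Yang--Baxter equation\<close>

text \<open>Both sides of every defining relation have length two, so letters are never identified.\<close>

lemma word_cong_short: "(u, v) \<in> word_cong N R k \<Longrightarrow> length u = length v \<and> (length u \<le> 1 \<longrightarrow> u = v)"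
proof (induction rule: pres_cong.induct)
  case (rel u v)
  then show ?case by (auto simp: FR_rels_def)
next
  case (sym u v)
  then show ?case by metis
next
  case (trans u v w)
  then show ?case by metis
next
  case (app u v u' v')
  then show ?case by (metis add_leD1 add_leD2 length_append)
qed simp

lemma word_cong_swap:
  assumes "1 \<le> i" "i < j" "j \<le> k" "s \<in> {1..N}" "t \<in> {1..N}" "R (s, t) = (t', s')"
    and "t' \<in> {1..N}" "s' \<in> {1..N}" "a \<in> words N k" "b \<in> words N k"
  shows "(a @ (i, s) # (j, t) # b, a @ (j, t') # (i, s') # b) \<in> word_cong N R k"
proof -
  have "([(i, s), (j, t)], [(j, t'), (i, s')]) \<in> word_cong N R k"
    using assms by (intro pres_cong.rel) (auto simp: FR_rels_def FR_gens_def)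
  then have "(a @ [(i, s), (j, t)] @ b, a @ [(j, t'), (i, s')] @ b) \<in> word_cong N R k"
    using assms by (intro pres_cong.app pres_cong.refl)
  then show ?thesis by simp
qed

lemma YBE_if_k_graph:
  assumes bij: "bij_betw R ({1..N} \<times> {1..N}) ({1..N} \<times> {1..N})"
    and "k \<ge> 3" and graph: "determines_single_vertex_k_graph N R k"
  shows "YBE_solution {1..N} R"
proof -
  have "(R12 R \<circ> R23 R \<circ> R12 R) (a, b, c) = (R23 R \<circ> R12 R \<circ> R23 R) (a, b, c)"
    if abc: "a \<in> {1..N}" "b \<in> {1..N}" "c \<in> {1..N}" for a b c
  proof -
    have cl: "\<exists>t' s'. R (s, t) = (t', s') \<and> t' \<in> {1..N} \<and> s' \<in> {1..N}"
      if "s \<in> {1..N}" "t \<in> {1..N}" for s t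
      using bij_betwE[OF bij] that by (cases "R (s, t)") fastforce
    \<comment> \<open>The exchanges of the colour pairs 12, 13, 23, in this order and in the opposite one.\<close>
    obtain b1 a1 where 1: "R (a, b) = (b1, a1)" "b1 \<in> {1..N}" "a1 \<in> {1..N}" using cl abc by meson
    obtain c1 a2 where 2: "R (a1, c) = (c1, a2)" "c1 \<in> {1..N}" "a2 \<in> {1..N}" using cl abc 1 by meson
    obtain c2 b2 where 3: "R (b1, c1) = (c2, b2)" "c2 \<in> {1..N}" "b2 \<in> {1..N}" using cl 1 2 by meson
    obtain c3 b3 where 4: "R (b, c) = (c3, b3)" "c3 \<in> {1..N}" "b3 \<in> {1..N}" using cl abc by meson
    obtain c4 a3 where 5: "R (a, c3) = (c4, a3)" "c4 \<in> {1..N}" "a3 \<in> {1..N}" using cl abc 4 by meson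
    obtain b4 a4 where 6: "R (a3, b3) = (b4, a4)" "b4 \<in> {1..N}" "a4 \<in> {1..N}" using cl 4 5 by meson
    note tr = pres_cong.trans[of _ _ "FR_gens N k" "FR_rels N R k"]
    have "([(1, a), (2, b), (3, c)], [(2, b1), (1, a1), (3, c)]) \<in> word_cong N R k"
      "([(2, b1), (1, a1), (3, c)], [(2, b1), (3, c1), (1, a2)]) \<in> word_cong N R k"
      "([(2, b1), (3, c1), (1, a2)], [(3, c2), (2, b2), (1, a2)]) \<in> word_cong N R k"
      using word_cong_swap[of 1 2 k a N b R b1 a1 "[]" "[(3, c)]"]
        word_cong_swap[of 1 3 k a1 N c R c1 a2 "[(2, b1)]" "[]"]
        word_cong_swap[of 2 3 k b1 N c1 R c2 b2 "[]" "[(1, a2)]"]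
        \<open>k \<ge> 3\<close> abc 1 2 3 by (simp_all add: FR_gens_def)
    then have l: "([(1, a), (2, b), (3, c)], [(3, c2), (2, b2), (1, a2)]) \<in> word_cong N R k"
      by (blast intro: tr)
    have "([(1, a), (2, b), (3, c)], [(1, a), (3, c3), (2, b3)]) \<in> word_cong N R k"
      "([(1, a), (3, c3), (2, b3)], [(3, c4), (1, a3), (2, b3)]) \<in> word_cong N R k"
      "([(3, c4), (1, a3), (2, b3)], [(3, c4), (2, b4), (1, a4)]) \<in> word_cong N R k"
      using word_cong_swap[of 2 3 k b N c R c3 b3 "[(1, a)]" "[]"]
        word_cong_swap[of 1 3 k a N c3 R c4 a3 "[]" "[(2, b3)]"]
        word_cong_swap[of 1 2 k a3 N b3 R b4 a4 "[(3, c4)]" "[]"]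
        \<open>k \<ge> 3\<close> abc 4 5 6 by (simp_all add: FR_gens_def)
    then have r: "([(1, a), (2, b), (3, c)], [(3, c4), (2, b4), (1, a4)]) \<in> word_cong N R k"
      by (blast intro: tr)
    have e: "([(3, c2), (2, b2), (1, a2)], [(3, c4), (2, b4), (1, a4)]) \<in> word_cong N R k"
      using l r by (blast intro: tr pres_cong.sym)
    have U: "(u, u') \<in> word_cong N R k \<and> (v, v') \<in> word_cong N R k"
      if "(u @ v, u' @ v') \<in> word_cong N R k"
        "word_degree u = word_degree u'" "word_degree v = word_degree v'" for u v u' v'
      using graph that unfolding determines_single_vertex_k_graph_iff by blast
    have e1: "([(3, c2)], [(3, c4)]) \<in> word_cong N R k"
      "([(2, b2), (1, a2)], [(2, b4), (1, a4)]) \<in> word_cong N R k"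
      using U[of "[(3, c2)]" "[(2, b2), (1, a2)]" "[(3, c4)]" "[(2, b4), (1, a4)]"] e
      by (simp_all add: word_degree_Cons)
    have e2: "([(2, b2)], [(2, b4)]) \<in> word_cong N R k" "([(1, a2)], [(1, a4)]) \<in> word_cong N R k"
      using U[of "[(2, b2)]" "[(1, a2)]" "[(2, b4)]" "[(1, a4)]"] e1
      by (simp_all add: word_degree_Cons)
    have "c2 = c4" "b2 = b4" "a2 = a4"
      using word_cong_short[OF e1(1)] word_cong_short[OF e2(1)] word_cong_short[OF e2(2)] by simp_all
    then show ?thesis
      using 1 2 3 4 5 6 by (simp add: R12_def R23_def)
  qed
  then show ?thesis
    using bij unfolding YBE_solution_def by auto
qed

section \<open>Normal forms for a solution of the Yang--Baxter equation\<close>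

text \<open>
  The letter moves right past the initial letters of smaller colour. A relation
  \<open>e\<^sup>j\<^sub>a e\<^sup>i\<^sub>b = e\<^sup>i\<^sub>s e\<^sup>j\<^sub>t\<close> with \<open>j < i\<close> and \<open>R (a, b) = (s, t)\<close> is used from right to left, hence the
  inverse of \<open>R\<close>. On words with ascending colours this is multiplication followed by sorting, but
  it is convenient to let it act on all words.
\<close>

fun insert_letter :: "nat \<Rightarrow> (nat \<times> nat \<Rightarrow> nat \<times> nat) \<Rightarrow> nat \<times> nat \<Rightarrow> (nat \<times> nat) list \<Rightarrow> (nat \<times> nat) list" where
  "insert_letter N R x [] = [x]"
| "insert_letter N R (i, s) ((j, t) # w) =
     (if i \<le> j then (i, s) # (j, t) # w
      else case inv_into ({1..N} \<times> {1..N}) R (s, t) of (a, b) \<Rightarrow> (j, a) # insert_letter N R (i, b) w)"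

locale square_bijection =
  fixes N :: nat and R :: "nat \<times> nat \<Rightarrow> nat \<times> nat"
  assumes bij: "bij_betw R ({1..N} \<times> {1..N}) ({1..N} \<times> {1..N})"
begin

abbreviation "ins \<equiv> insert_letter N R"

lemma R_image:
  assumes "R (s, t) = (t', s')" "s \<in> {1..N}" "t \<in> {1..N}"
  shows "t' \<in> {1..N} \<and> s' \<in> {1..N}"
  using bij_betw_apply[OF bij SigmaI[OF assms(2,3)]] unfolding assms(1) by (rule iffD1[OF mem_Sigma_iff])

lemma R_closed:
  assumes "s \<in> {1..N}" "t \<in> {1..N}"
  obtains t' s' where "R (s, t) = (t', s')" "t' \<in> {1..N}" "s' \<in> {1..N}"
proof -
  have "R (s, t) \<in> {1..N} \<times> {1..N}"
    using bij_betw_apply[OF bij] assms by simp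
  then show ?thesis using that[of "fst (R (s, t))" "snd (R (s, t))"] by (simp add: mem_Times_iff)
qed

lemma R_preimage:
  assumes "s \<in> {1..N}" "t \<in> {1..N}"
  obtains a b where "R (a, b) = (s, t)" "a \<in> {1..N}" "b \<in> {1..N}"
proof -
  have "(s, t) \<in> R ` ({1..N} \<times> {1..N})"
    using bij assms by (simp add: bij_betw_def)
  then obtain p where "(s, t) = R p" "p \<in> {1..N} \<times> {1..N}" by (rule imageE)
  then show ?thesis using that[of "fst p" "snd p"] by (simp add: mem_Times_iff)
qed

lemma R_inject:
  "\<lbrakk>R (a, b) = R (a', b'); a \<in> {1..N}; b \<in> {1..N}; a' \<in> {1..N}; b' \<in> {1..N}\<rbrakk> \<Longrightarrow> a = a' \<and> b = b'"
  using inj_onD[OF bij_betw_imp_inj_on[OF bij], of "(a, b)" "(a', b')"] by simp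

lemma insert_letter_pass:
  assumes "j < i" "R (a, b) = (s, t)" "a \<in> {1..N}" "b \<in> {1..N}"
  shows "ins (i, s) ((j, t) # w) = (j, a) # ins (i, b) w"
proof -
  have "inv_into ({1..N} \<times> {1..N}) R (s, t) = (a, b)"
    using inv_into_f_f[OF bij_betw_imp_inj_on[OF bij], of "(a, b)"] assms by simp
  then show ?thesis using assms by simp
qed

declare insert_letter.simps(2)[simp del]

lemma insert_letter_stop: "i \<le> j \<Longrightarrow> ins (i, s) ((j, t) # w) = (i, s) # (j, t) # w"
  by (simp add: insert_letter.simps(2))

lemma insert_letter_words:
  "\<lbrakk>x \<in> FR_gens N k; w \<in> words N k\<rbrakk> \<Longrightarrow> ins x w \<in> words N k"
proof (induction w arbitrary: x)
  case (Cons y w)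
  obtain i s j t where xy: "x = (i, s)" "y = (j, t)" by (metis surj_pair)
  show ?case
  proof (cases "i \<le> j")
    case True
    then show ?thesis using Cons.prems by (simp add: xy insert_letter_stop)
  next
    case False
    have st: "s \<in> {1..N}" "t \<in> {1..N}" using Cons.prems by (auto simp: xy FR_gens_def)
    obtain a b where ab: "R (a, b) = (s, t)" "a \<in> {1..N}" "b \<in> {1..N}" using R_preimage[OF st] .
    have "ins (i, b) w \<in> words N k"
      using Cons ab by (auto simp: xy FR_gens_def)
    then show ?thesis
      using False Cons.prems ab by (simp add: xy insert_letter_pass) (simp add: FR_gens_def)
  qed
qed simp

lemma word_cong_insert_letter:
  "\<lbrakk>x \<in> FR_gens N k; w \<in> words N k\<rbrakk> \<Longrightarrow> (x # w, ins x w) \<in> word_cong N R k"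
proof (induction w arbitrary: x)
  case Nil
  then show ?case by (simp add: pres_cong.refl)
next
  case (Cons y w)
  obtain i s j t where xy: "x = (i, s)" "y = (j, t)" by (metis surj_pair)
  show ?case
  proof (cases "i \<le> j")
    case True
    then show ?thesis using Cons.prems by (simp add: xy insert_letter_stop pres_cong.refl)
  next
    case False
    have st: "s \<in> {1..N}" "t \<in> {1..N}" using Cons.prems by (auto simp: xy FR_gens_def)
    obtain a b where ab: "R (a, b) = (s, t)" "a \<in> {1..N}" "b \<in> {1..N}" using R_preimage[OF st] .
    have "((j, a) # (i, b) # w, (i, s) # (j, t) # w) \<in> word_cong N R k"
      using word_cong_swap[of j i k a N b R s t "[]" w] False st ab Cons.prems
      by (simp add: xy FR_gens_def)
    moreover have "((i, b) # w, ins (i, b) w) \<in> word_cong N R k"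
      using Cons ab by (auto simp: xy FR_gens_def)
    then have "([(j, a)] @ (i, b) # w, [(j, a)] @ ins (i, b) w) \<in> word_cong N R k"
      using Cons.prems ab by (intro pres_cong.app pres_cong.refl) (auto simp: xy FR_gens_def)
    ultimately show ?thesis
      using False ab by (auto simp: xy insert_letter_pass intro: pres_cong.sym pres_cong.trans)
  qed
qed

text \<open>
  The insertion operators satisfy the defining relations. The only substantial case is that both
  letters \<open>e\<^sup>i\<close>, \<open>e\<^sup>j\<close> pass a letter of colour \<open>c < i < j\<close>: this starts from colours \<open>i j c\<close> and ends
  with \<open>c\<close> in front, so that both sides are read off the two ways of computing the Yang--Baxter
  transform of one triple \<open>v\<close> with colours \<open>c i j\<close>.
\<close>

lemma insert_letter_commute:
  assumes YBE: "YBE_solution {1..N} R" and "i < j"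
  shows "\<lbrakk>R (s, t) = (t', s'); s \<in> {1..N}; t \<in> {1..N}; w \<in> words N k\<rbrakk> \<Longrightarrow>
    ins (i, s) (ins (j, t) w) = ins (j, t') (ins (i, s') w)"
proof (induction w arbitrary: s t s' t')
  case Nil
  then show ?case
    using \<open>i < j\<close> by (simp add: insert_letter_stop insert_letter_pass)
next
  case (Cons y w)
  obtain c z where y: "y = (c, z)" by (metis surj_pair)
  have z: "z \<in> {1..N}" using Cons.prems by (auto simp: y FR_gens_def)
  have s't': "s' \<in> {1..N}" "t' \<in> {1..N}"
    using R_image[OF Cons.prems(1-3)] by simp_all
  consider "j \<le> c" | "i \<le> c" "c < j" | "c < i" by linarith
  then show ?case
  proof cases
    case 1
    then show ?thesis
      using \<open>i < j\<close> Cons.prems by (simp add: y insert_letter_stop insert_letter_pass)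
  next
    case 2
    obtain z1 t1 where 1: "R (z1, t1) = (t, z)" "z1 \<in> {1..N}" "t1 \<in> {1..N}"
      by (rule R_preimage[OF Cons.prems(3) z])
    then show ?thesis
      using \<open>i < j\<close> 2 Cons.prems by (simp add: y insert_letter_stop insert_letter_pass)
  next
    case 3
    \<comment> \<open>On the left first \<open>e\<^sup>j\<close> and then \<open>e\<^sup>i\<close> passes; on the right the other way round.\<close>
    obtain z1 t1 where 1: "R (z1, t1) = (t, z)" "z1 \<in> {1..N}" "t1 \<in> {1..N}"
      by (rule R_preimage[OF Cons.prems(3) z])
    obtain z2 s1 where 2: "R (z2, s1) = (s, z1)" "z2 \<in> {1..N}" "s1 \<in> {1..N}"
      by (rule R_preimage[OF Cons.prems(2) 1(2)])
    obtain z3 s2 where 3: "R (z3, s2) = (s', z)" "z3 \<in> {1..N}" "s2 \<in> {1..N}"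
      by (rule R_preimage[OF s't'(1) z])
    obtain z4 t2 where 4: "R (z4, t2) = (t', z3)" "z4 \<in> {1..N}" "t2 \<in> {1..N}"
      by (rule R_preimage[OF s't'(2) 3(2)])
    \<comment> \<open>The triple \<open>v\<close> is \<open>(z2, s1, t1)\<close>.\<close>
    obtain b a where 5: "R (s1, t1) = (b, a)" "b \<in> {1..N}" "a \<in> {1..N}"
      by (rule R_closed[OF 2(3) 1(3)])
    obtain p q where 6: "R (z2, b) = (p, q)" "p \<in> {1..N}" "q \<in> {1..N}"
      by (rule R_closed[OF 2(2) 5(2)])
    have "(R12 R \<circ> R23 R \<circ> R12 R) (z2, s1, t1) = (R23 R \<circ> R12 R \<circ> R23 R) (z2, s1, t1)"
      using YBE 1 2 unfolding YBE_solution_def by blast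
    then have e: "p = t'" "R (q, a) = (s', z)"
      using 1 2 5 6 Cons.prems by (auto simp: R12_def R23_def)
    have "q = z3" "a = s2"
      using R_inject[of q a z3 s2] e 3 5 6 by auto
    moreover from this have "z2 = z4" "b = t2"
      using R_inject[of z2 b z4 t2] e 2 4 5 6 by auto
    ultimately have "ins (i, s1) (ins (j, t1) w) = ins (j, t2) (ins (i, s2) w)"
      using Cons.IH[OF 5(1)] 1 2 Cons.prems by auto
    then show ?thesis
      using \<open>c < i\<close> \<open>i < j\<close> 1 2 3 4 \<open>z2 = z4\<close> by (simp add: y insert_letter_pass)
  qed
qed

lemma foldr_insert_letter_words:
  "\<lbrakk>u \<in> words N k; w \<in> words N k\<rbrakk> \<Longrightarrow> foldr ins u w \<in> words N k"
proof (induction u)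
  case (Cons x u)
  then show ?case using insert_letter_words[of x k "foldr ins u w"] by simp
qed simp

lemma foldr_insert_letter_cong:
  assumes YBE: "YBE_solution {1..N} R"
  shows "\<lbrakk>(u, v) \<in> word_cong N R k; w \<in> words N k\<rbrakk> \<Longrightarrow> foldr ins u w = foldr ins v w"
proof (induction arbitrary: w rule: pres_cong.induct)
  case (rel u v)
  then obtain i j s t s' t' where "i < j" "s \<in> {1..N}" "t \<in> {1..N}" "R (s, t) = (t', s')"
    and "u = [(i, s), (j, t)]" "v = [(j, t'), (i, s')]"
    by (auto simp: FR_rels_def)
  then show ?case
    using insert_letter_commute[OF YBE _ _ _ _ rel.prems, of i j s t t' s'] by simp
next
  case (app u v u' v')
  have "foldr ins v' w \<in> words N k"
    using foldr_insert_letter_words app pres_cong_lists by blast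
  then show ?case using app by simp
qed auto

lemma word_cong_normal_form:
  "u \<in> words N k \<Longrightarrow> (u, foldr ins u []) \<in> word_cong N R k"
proof (induction u)
  case Nil
  then show ?case by (simp add: pres_cong.refl)
next
  case (Cons x u)
  have "([x] @ u, [x] @ foldr ins u []) \<in> word_cong N R k"
    using Cons by (intro pres_cong.app pres_cong.refl) auto
  moreover have "(x # foldr ins u [], ins x (foldr ins u [])) \<in> word_cong N R k"
    using Cons.prems foldr_insert_letter_words by (intro word_cong_insert_letter) auto
  ultimately show ?case by (auto intro: pres_cong.trans)
qed

lemma length_insert_letter: "length (ins x w) = Suc (length w)"
  by (induction N R x w rule: insert_letter.induct) (auto simp: insert_letter.simps(2) split: prod.split)

text \<open>
  The colour of the inserted letter tells where the letter ended up: if the result starts with a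
  smaller colour, then the letter has passed and \<open>R\<close> undoes the step; otherwise it stands in front.
\<close>

lemma insert_letter_inject:
  "\<lbrakk>ins (i, s) w = ins (i, s') w'; (i, s) \<in> FR_gens N k; (i, s') \<in> FR_gens N k;
    w \<in> words N k; w' \<in> words N k\<rbrakk> \<Longrightarrow> s = s' \<and> w = w'"
proof (induction w arbitrary: s s' w')
  case Nil
  then have "w' = []"
    by (metis length_insert_letter length_0_conv nat.inject)
  then show ?case using Nil.prems by simp
next
  case (Cons y w)
  have "length w' = Suc (length w)"
    using Cons.prems(1) length_insert_letter[of "(i, s)" "y # w"] length_insert_letter[of "(i, s')" w']
    by simp
  then obtain y' v where w': "w' = y' # v" by (cases w') auto
  obtain j t j' t' where y: "y = (j, t)" "y' = (j', t')" by (metis surj_pair)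
  have N: "s \<in> {1..N}" "t \<in> {1..N}" "s' \<in> {1..N}" "t' \<in> {1..N}" and l: "w \<in> words N k" "v \<in> words N k"
    using Cons.prems by (auto simp: w' y FR_gens_def)
  obtain a b where ab: "R (a, b) = (s, t)" "a \<in> {1..N}" "b \<in> {1..N}"
    by (rule R_preimage[OF N(1,2)])
  obtain a' b' where ab': "R (a', b') = (s', t')" "a' \<in> {1..N}" "b' \<in> {1..N}"
    by (rule R_preimage[OF N(3,4)])
  consider "i \<le> j" "i \<le> j'" | "i \<le> j" "j' < i" | "j < i" "i \<le> j'" | "j < i" "j' < i"
    by linarith
  then show ?case
  proof cases
    case 4
    then have "j = j'" "a = a'" and eq: "ins (i, b) w = ins (i, b') v"
      using Cons.prems(1) ab ab' by (simp_all add: w' y insert_letter_pass)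
    moreover have "b = b' \<and> w = v"
      using Cons.IH[OF eq] Cons.prems ab ab' l by (auto simp: FR_gens_def)
    ultimately show ?thesis
      using ab ab' by (simp add: w' y)
  qed (use Cons.prems(1) ab ab' in \<open>simp_all add: w' y insert_letter_stop insert_letter_pass\<close>)
qed

section \<open>Existence and uniqueness of factorizations\<close>

text \<open>
  On normal forms, multiplication by a letter is insertion, so cancellation reduces to injectivity of
  insertion.
\<close>

lemma word_cong_letter_cancel:
  assumes YBE: "YBE_solution {1..N} R"
    and c: "((i, s) # v, (i, s') # v') \<in> word_cong N R k"
  shows "s = s' \<and> (v, v') \<in> word_cong N R k"
proof -
  have l: "(i, s) \<in> FR_gens N k" "(i, s') \<in> FR_gens N k" "v \<in> words N k" "v' \<in> words N k"
    using pres_cong_lists[OF c] by auto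
  have "ins (i, s) (foldr ins v []) = ins (i, s') (foldr ins v' [])"
    using foldr_insert_letter_cong[OF YBE c, of "[]"] by simp
  then have e: "s = s'" "foldr ins v [] = foldr ins v' []"
    using insert_letter_inject l foldr_insert_letter_words lists.Nil by blast+
  have "(v, foldr ins v []) \<in> word_cong N R k" "(v', foldr ins v []) \<in> word_cong N R k"
    using word_cong_normal_form[OF l(3)] word_cong_normal_form[OF l(4)] e(2) by simp_all
  then show ?thesis
    using e by (blast intro: pres_cong.sym pres_cong.trans)
qed

text \<open>
  A letter can pass any letter of another colour: the relations are used from left to right past a
  larger colour and, since \<open>R\<close> is onto, from right to left past a smaller one.
\<close>

lemma word_cong_letter_pass:
  "\<lbrakk>(i, s) \<in> FR_gens N k; u \<in> words N k; word_degree u i = 0\<rbrakk> \<Longrightarrow>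
    \<exists>s' u'. s' \<in> {1..N} \<and> u' \<in> words N k \<and> ((i, s) # u, u' @ [(i, s')]) \<in> word_cong N R k"
proof (induction u arbitrary: s)
  case Nil
  then show ?case
    by (intro exI[of _ s] exI[of _ "[]"]) (auto simp: FR_gens_def pres_cong.refl)
next
  case (Cons y u)
  obtain j t where y: "y = (j, t)" by (metis surj_pair)
  have ij: "i \<noteq> j" and u: "word_degree u i = 0"
    using Cons.prems by (auto simp: y word_degree_Cons Nk_add_def Nk_unit_def)
  have st: "s \<in> {1..N}" "t \<in> {1..N}" using Cons.prems by (auto simp: y FR_gens_def)
  have "\<exists>t' s'. t' \<in> {1..N} \<and> s' \<in> {1..N} \<and>
      ((i, s) # (j, t) # u, (j, t') # (i, s') # u) \<in> word_cong N R k"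
  proof (cases "i < j")
    case True
    obtain t' s' where "R (s, t) = (t', s')" "t' \<in> {1..N}" "s' \<in> {1..N}"
      by (rule R_closed[OF st])
    then show ?thesis
      using True st word_cong_swap[of i j k s N t R t' s' "[]" u] Cons.prems
      by (auto simp: y FR_gens_def)
  next
    case False
    obtain t' s' where "R (t', s') = (s, t)" "t' \<in> {1..N}" "s' \<in> {1..N}"
      by (rule R_preimage[OF st])
    then show ?thesis
      using False ij st word_cong_swap[of j i k t' N s' R s t "[]" u] Cons.prems
      by (auto simp: y FR_gens_def intro: pres_cong.sym)
  qed
  then obtain t' s1 where 1: "t' \<in> {1..N}" "s1 \<in> {1..N}"
    "((i, s) # y # u, (j, t') # (i, s1) # u) \<in> word_cong N R k" using y by blast
  have "(i, s1) \<in> FR_gens N k" "u \<in> words N k" and j: "[(j, t')] \<in> words N k"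
    using 1 Cons.prems by (auto simp: y FR_gens_def)
  with Cons.IH u obtain s' u' where 2: "s' \<in> {1..N}" "u' \<in> words N k"
    "((i, s1) # u, u' @ [(i, s')]) \<in> word_cong N R k" by blast
  have "([(j, t')] @ (i, s1) # u, [(j, t')] @ u' @ [(i, s')]) \<in> word_cong N R k"
    by (intro pres_cong.app pres_cong.refl j 2)
  then have "((i, s) # y # u, ((j, t') # u') @ [(i, s')]) \<in> word_cong N R k"
    using 1 by (auto intro: pres_cong.trans)
  moreover have "(j, t') # u' \<in> words N k" using j 2 by simp
  ultimately show ?case using 2 by blast
qed

text \<open>
  The first letter of the word goes to the left factor if that still needs its colour. If not, the
  left factor has no letter of this colour at all, so the letter can be moved behind it.
\<close>

lemma factorization_exists:
  "\<lbrakk>w \<in> words N k; word_degree w = Nk_add m n\<rbrakk> \<Longrightarrow>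
    \<exists>u v. u \<in> words N k \<and> v \<in> words N k \<and> word_degree u = m \<and> word_degree v = n \<and>
      (w, u @ v) \<in> word_cong N R k"
proof (induction w arbitrary: m n)
  case Nil
  then have "m = (\<lambda>_. 0)" "n = (\<lambda>_. 0)"
    by (auto simp: word_degree_Nil Nk_add_def fun_eq_iff)
  then show ?case
    using pres_cong.refl[of "[]"] by (intro exI[of _ "[]"]) (simp add: word_degree_Nil)
next
  case (Cons x w)
  obtain i s where x: "x = (i, s)" by (metis surj_pair)
  have xw: "[x] \<in> words N k" "w \<in> words N k" using Cons.prems by auto
  have d: "(if l = i then 1 else 0) + word_degree w l = m l + n l" for l
    using Cons.prems by (simp add: x word_degree_Cons Nk_add_def Nk_unit_def fun_eq_iff)
  show ?case
  proof (cases "m i = 0")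
    case False
    let ?m = "m(i := m i - 1)"
    have "word_degree w = Nk_add ?m n"
      using d False by (fastforce simp: Nk_add_def fun_eq_iff split: if_splits)
    then obtain u v where uv: "u \<in> words N k" "v \<in> words N k" "word_degree u = ?m"
      "word_degree v = n" "(w, u @ v) \<in> word_cong N R k" using Cons.IH xw by blast
    have "([x] @ w, [x] @ u @ v) \<in> word_cong N R k"
      by (intro pres_cong.app pres_cong.refl xw uv)
    moreover have "word_degree (x # u) = m"
      using False uv by (auto simp: x word_degree_Cons Nk_add_def Nk_unit_def fun_eq_iff)
    ultimately show ?thesis
      using uv xw by (intro exI[of _ "x # u"] exI[of _ v]) simp
  next
    case True
    let ?n = "n(i := n i - 1)"
    have ni: "n i \<noteq> 0" using d[of i] True by simp
    have "word_degree w = Nk_add m ?n"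
      using d True ni by (fastforce simp: Nk_add_def fun_eq_iff split: if_splits)
    then obtain u v where uv: "u \<in> words N k" "v \<in> words N k" "word_degree u = m"
      "word_degree v = ?n" "(w, u @ v) \<in> word_cong N R k" using Cons.IH xw by blast
    obtain s' u' where u': "s' \<in> {1..N}" "u' \<in> words N k"
      "(x # u, u' @ [(i, s')]) \<in> word_cong N R k"
      using word_cong_letter_pass[of i s k u] uv True xw by (auto simp: x)
    have "([x] @ w, [x] @ u @ v) \<in> word_cong N R k"
      by (intro pres_cong.app pres_cong.refl xw uv)
    moreover have "((x # u) @ v, (u' @ [(i, s')]) @ v) \<in> word_cong N R k"
      by (intro pres_cong.app pres_cong.refl u' uv)
    ultimately have "(x # w, u' @ (i, s') # v) \<in> word_cong N R k"
      by (auto intro: pres_cong.trans)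
    moreover have "word_degree u' = m"
      using word_degree_cong[OF u'(3)] uv
      by (auto simp: x word_degree_append word_degree_Cons word_degree_Nil Nk_add_def fun_eq_iff)
    moreover have "word_degree ((i, s') # v) = n"
      using ni uv by (auto simp: word_degree_Cons Nk_add_def Nk_unit_def fun_eq_iff)
    moreover have "(i, s') # v \<in> words N k"
      using u' uv xw by (auto simp: x FR_gens_def)
    ultimately show ?thesis using u' by blast
  qed
qed

text \<open>
  The two left factors may have their colours in different orders. Before letters can be compared,
  the second one is rewritten so as to start with the colour of the first letter of the other.
\<close>

lemma factorization_unique:
  assumes YBE: "YBE_solution {1..N} R"
  shows "\<lbrakk>(u @ v, u' @ v') \<in> word_cong N R k; word_degree u = word_degree u'\<rbrakk> \<Longrightarrow>
    (u, u') \<in> word_cong N R k \<and> (v, v') \<in> word_cong N R k"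
proof (induction u arbitrary: u')
  case Nil
  then have "u' = []" by (metis word_degree_Nil word_degree_eq_zero)
  then show ?case using Nil by (simp add: pres_cong.refl)
next
  case (Cons x u)
  obtain i s where x: "x = (i, s)" by (metis surj_pair)
  have l: "[x] \<in> words N k" "u' \<in> words N k" "v' \<in> words N k"
    using pres_cong_lists[OF Cons.prems(1)] by auto
  have "word_degree u' = Nk_add (Nk_unit i) (word_degree u)"
    using Cons.prems by (simp add: x word_degree_Cons)
  then obtain a b where ab: "word_degree a = Nk_unit i" "word_degree b = word_degree u"
    "(u', a @ b) \<in> word_cong N R k" using factorization_exists[OF l(2)] by blast
  obtain s' where a: "a = [(i, s')]" using ab(1) word_degree_eq_unit by blast
  have "(u' @ v', (a @ b) @ v') \<in> word_cong N R k"
    by (intro pres_cong.app pres_cong.refl l ab)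
  then have "((i, s) # u @ v, (i, s') # b @ v') \<in> word_cong N R k"
    using Cons.prems(1) by (auto simp: x a intro: pres_cong.trans)
  then have s: "s = s'" and c: "(u @ v, b @ v') \<in> word_cong N R k"
    using word_cong_letter_cancel[OF YBE] by blast+
  then have ub: "(u, b) \<in> word_cong N R k" and v: "(v, v') \<in> word_cong N R k"
    using Cons.IH ab(2) by auto
  have "([x] @ u, [x] @ b) \<in> word_cong N R k"
    by (intro pres_cong.app pres_cong.refl l ub)
  then have "(x # u, u') \<in> word_cong N R k"
    using ab(3) by (auto simp: x a s intro: pres_cong.sym pres_cong.trans)
  then show ?case using v by blast
qed

lemma k_graph_if_YBE:
  assumes "YBE_solution {1..N} R"
  shows "determines_single_vertex_k_graph N R k"
  unfolding determines_single_vertex_k_graph_iff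
proof (rule conjI; intro ballI allI impI)
  fix w m n
  assume "w \<in> words N k" "word_degree w = Nk_add m n"
  then show "\<exists>u v. u \<in> words N k \<and> v \<in> words N k \<and> word_degree u = m \<and> word_degree v = n \<and>
      (w, u @ v) \<in> word_cong N R k"
    by (rule factorization_exists)
next
  fix u v u' v'
  assume "(u @ v, u' @ v') \<in> word_cong N R k \<and>
    word_degree u = word_degree u' \<and> word_degree v = word_degree v'"
  then show "(u, u') \<in> word_cong N R k \<and> (v, v') \<in> word_cong N R k"
    by (elim conjE) (rule factorization_unique[OF assms])
qed

end

theorem theorem4p1:
  fixes N :: nat and R :: "nat \<times> nat \<Rightarrow> nat \<times> nat"
  assumes "N \<ge> 1"
    and "bij_betw R ({1..N} \<times> {1..N}) ({1..N} \<times> {1..N})"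
  shows "(YBE_solution {1..N} R \<longleftrightarrow> determines_single_vertex_k_graph N R 3)
       \<and> (determines_single_vertex_k_graph N R 3
            \<longleftrightarrow> (\<forall>k\<ge>3. determines_single_vertex_k_graph N R k))"
proof -
  interpret square_bijection N R
    using assms(2) by unfold_locales
  show ?thesis
    using k_graph_if_YBE YBE_if_k_graph[OF assms(2), of 3] by auto
qed

end
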